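(* Let $\mathbb E$ be a finite-dimensional Euclidean space, $\Lambda\subset\mathbb E$, and let $T:\mathbb E\rightrightarrows\mathbb E$ satisfy $T(x)\subset\Lambda$ for all $x\in\Lambda$. Let $S\subset\operatorname{ri}\Lambda$ be closed and nonempty with $Ty\subset\operatorname{Fix}T\cap S$ for all $y\in S$. Let $\mathcal O$ be a neighborhood of $S$ such that $\mathcal O\cap\Lambda\subset\operatorname{ri}\Lambda$. Suppose (a) $T$ is pointwise almost averaged at all points $y\in S$ with violation $\varepsilon$ and averaging constant $\alpha\in(0,1)$ on $\mathcal O\cap\Lambda$, and (b) there exists a neighborhood $\mathcal V$ of $\operatorname{Fix}T\cap S$ and a $\kappa>0$ such that for all $y^+\in Ty$, $y\in S$, and all $x^+\in Tx$ the estimate $$\operatorname{dist}(x,S)\le\kappa\|(x-x^+)-(y-y^+)\|$$ holds whenever $x\in(\mathcal O\cap\Lambda)\setminus(\mathcal V\cap\Lambda)$. Then for all $x^+\in Tx$ $$\operatorname{dist}(x^+,\operatorname{Fix}T\cap S)\le\sqrt{1+\varepsilon-\frac{1-\alpha}{\kappa^2\alpha}}\;\operatorname{dist}(x,S)$$ whenever $x\in(\mathcal O\cap\Lambda)\setminus(\mathcal V\cap\Lambda)$. In particular, if $\kappa<\sqrt{\frac{1-\alpha}{\varepsilon\alpha}}$, then for all $x^0\in\mathcal O\cap\Lambda$ the iteration $x^{j+1}\in Tx^j$ satisfies $$\operatorname{dist}(x^{j+1},\operatorname{Fix}T\cap S)\le c^j\operatorname{dist}(x^0,S)$$ with $c:=\big(1+\varepsilon-\frac{1-\alpha}{\alpha\kappa^2}\big)^{1/2}<1$,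 for all $j$ such that $x^i\in(\mathcal O\cap\Lambda)\setminus(\mathcal V\cap\Lambda)$ for $i=1,2,\dots,j$.
   Context: $\operatorname{Fix}T=\{x: x\in Tx\}$; $\operatorname{ri}$ denotes relative interior. For $\varepsilon=0$ the bound $\sqrt{(1-\alpha)/(\varepsilon\alpha)}$ is read as $+\infty$. $T$ is pointwise almost averaged on $D$ at $y\in D$ with averaging constant $\alpha\in(0,1)$ and violation constant $\varepsilon\in[0,1)$ if the mapping $\tilde T$ defined by $T=(1-\alpha)\mathrm{Id}+\alpha\tilde T$ satisfies $\|\tilde x^+-\tilde y^+\|\le\sqrt{1+\varepsilon/\alpha}\,\|x-y\|$ for all $\tilde y^+\in\tilde Ty$ and all $\tilde x^+\in\tilde Tx$, $x\in D$; equivalently, $\|x^+-y^+\|^2\le(1+\varepsilon)\|x-y\|^2-\frac{1-\alpha}{\alpha}\|(x-x^+)-(y-y^+)\|^2$ for all $x\in D$, $x^+\in Tx$, $y^+\in Ty$.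
   Formalization: T y is assumed nonempty for y in S; the bound c^j dist(x^0,S) is claimed when x^0 is not in V or ε=0, and otherwise (where it can fail) with an extra factor sqrt(1+ε); a negative radicand in c is replaced by 0. *)

theory Defs
  imports "HOL-Analysis.Analysis"
begin

text \<open>A multivalued map from \<open>'a\<close> to \<open>'a\<close> is represented as a function into sets.\<close>

definition Fix_pts :: "('a \<Rightarrow> 'a set) \<Rightarrow> 'a set" where
  "Fix_pts T = {x. x \<in> T x}"

definition nbhd_of :: "'a::topological_space set \<Rightarrow> 'a set \<Rightarrow> bool" where
  "nbhd_of U S \<longleftrightarrow> S \<subseteq> interior U"

text \<open>The unique multivalued map \<open>T'\<close> with \<open>T = (1 - \<alpha>) Id + \<alpha> T'\<close> (for \<open>\<alpha> \<noteq> 0\<close>).\<close>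

definition averaging_part :: "real \<Rightarrow> ('a::real_vector \<Rightarrow> 'a set) \<Rightarrow> 'a \<Rightarrow> 'a set" where
  "averaging_part \<alpha> T x = {u. (1 - \<alpha>) *\<^sub>R x + \<alpha> *\<^sub>R u \<in> T x}"

definition pointwise_almost_averaged ::
    "('a::real_normed_vector \<Rightarrow> 'a set) \<Rightarrow> 'a set \<Rightarrow> 'a \<Rightarrow> real \<Rightarrow> real \<Rightarrow> bool" where
  "pointwise_almost_averaged T D y \<epsilon> \<alpha> \<longleftrightarrow>
     0 < \<alpha> \<and> \<alpha> < 1 \<and> 0 \<le> \<epsilon> \<and> \<epsilon> < 1 \<and> y \<in> D \<and>
     (\<forall>v \<in> averaging_part \<alpha> T y. \<forall>x \<in> D. \<forall>u \<in> averaging_part \<alpha> T x.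
        norm (u - v) \<le> sqrt (1 + \<epsilon> / \<alpha>) * norm (x - y))"

end

theory Submission
  imports Defs
begin

text \<open>
  Expanding the norm of the convex combination \<open>x' - y'\<close> turns the Lipschitz bound for the
  averaging part into a bound on its square by \<open>(1 + \<epsilon>) \<parallel>x - y\<parallel>\<^sup>2\<close> minus a multiple of
  \<open>\<parallel>(x - x') - (y - y')\<parallel>\<^sup>2\<close>, and (b) bounds the latter below by a multiple of \<open>dist(x, S)\<^sup>2\<close>.
  Apply it to a nearest point \<open>y \<in> S\<close> of \<open>x\<close>: the images of \<open>y\<close> lie in \<open>Fix T \<inter> S\<close>, which
  gives the one-step contraction. Since \<open>Fix T \<inter> S \<subseteq> S\<close>, the one-step bounds can be chained.
\<close>

lemma norm_affine_comb_squared: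
  fixes a b :: "'a::real_inner"
  shows "(norm ((1 - t) *\<^sub>R a + t *\<^sub>R b))\<^sup>2
    = (1 - t) * (norm a)\<^sup>2 + t * (norm b)\<^sup>2 - t * (1 - t) * (norm (a - b))\<^sup>2"
  by (simp add: power2_norm_eq_inner inner_simps inner_commute algebra_simps)

text \<open>Where the constants come from: weighted by \<alpha>, the squared Lipschitz bound
  contributes \<open>\<alpha> + \<epsilon>\<close>, and the affine identity adds
  \<open>1 - \<alpha>\<close>, so the total factor is \<open>1 + \<epsilon>\<close>.\<close>

lemma pointwise_almost_averaged_norm_le:
  fixes T :: "'a::real_inner \<Rightarrow> 'a set"
  assumes avg: "pointwise_almost_averaged T D y \<epsilon> \<alpha>"
    and x: "x \<in> D" "x' \<in> T x" and y': "y' \<in> T y"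
  shows "(norm (x' - y'))\<^sup>2
    \<le> (1 + \<epsilon>) * (norm (x - y))\<^sup>2 - (1 - \<alpha>) / \<alpha> * (norm ((x - x') - (y - y')))\<^sup>2"
proof -
  have \<alpha>: "0 < \<alpha>" and \<epsilon>: "0 \<le> \<epsilon>"
    using avg by (auto simp: pointwise_almost_averaged_def)
  \<comment> \<open>Solving \<open>(1 - \<alpha>) *\<^sub>R x + \<alpha> *\<^sub>R u = x'\<close>
    for \<open>u\<close>, and likewise for \<open>v\<close>, exhibits the elements of the averaging
    part that correspond to \<open>x'\<close> and \<open>y'\<close>.\<close>
  define u v where "u = (1 / \<alpha>) *\<^sub>R (x' - (1 - \<alpha>) *\<^sub>R x)" and "v = (1 / \<alpha>) *\<^sub>R (y' - (1 - \<alpha>) *\<^sub>R y)"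
  have u: "(1 - \<alpha>) *\<^sub>R x + \<alpha> *\<^sub>R u = x'" and v: "(1 - \<alpha>) *\<^sub>R y + \<alpha> *\<^sub>R v = y'"
    using \<alpha> by (auto simp: u_def v_def)
  have "u \<in> averaging_part \<alpha> T x" "v \<in> averaging_part \<alpha> T y"
    using x y' u v by (auto simp: averaging_part_def)
  then have "norm (u - v) \<le> sqrt (1 + \<epsilon> / \<alpha>) * norm (x - y)"
    using avg x by (auto simp: pointwise_almost_averaged_def)
  then have "(norm (u - v))\<^sup>2 \<le> (sqrt (1 + \<epsilon> / \<alpha>) * norm (x - y))\<^sup>2"
    by (rule power_mono) simp
  then have "(norm (u - v))\<^sup>2 \<le> (1 + \<epsilon> / \<alpha>) * (norm (x - y))\<^sup>2"
    using \<alpha> \<epsilon> by (simp add: power_mult_distrib)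
  then have "\<alpha> * (norm (u - v))\<^sup>2 \<le> \<alpha> * ((1 + \<epsilon> / \<alpha>) * (norm (x - y))\<^sup>2)"
    using \<alpha> by (intro mult_left_mono) auto
  also have "\<dots> = (\<alpha> + \<epsilon>) * (norm (x - y))\<^sup>2"
    using \<alpha> by (simp add: field_simps)
  finally have uv: "\<alpha> * (norm (u - v))\<^sup>2 \<le> (\<alpha> + \<epsilon>) * (norm (x - y))\<^sup>2" .
  have diff: "x' - y' = (1 - \<alpha>) *\<^sub>R (x - y) + \<alpha> *\<^sub>R (u - v)"
    by (simp add: u[symmetric] v[symmetric] algebra_simps)
  then have "(x - x') - (y - y') = \<alpha> *\<^sub>R ((x - y) - (u - v))"
    by (simp add: algebra_simps)
  then have res: "(norm ((x - x') - (y - y')))\<^sup>2 = \<alpha>\<^sup>2 * (norm ((x - y) - (u - v)))\<^sup>2"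
    by (simp add: power_mult_distrib)
  have "(norm (x' - y'))\<^sup>2 = (1 - \<alpha>) * (norm (x - y))\<^sup>2 + \<alpha> * (norm (u - v))\<^sup>2
      - \<alpha> * (1 - \<alpha>) * (norm ((x - y) - (u - v)))\<^sup>2"
    unfolding diff by (rule norm_affine_comb_squared)
  \<comment> \<open>The residual is \<alpha> times \<open>(x - y) - (u - v)\<close>; pulling out its
    factor \<open>\<alpha>\<^sup>2\<close> turns \<open>\<alpha> * (1 - \<alpha>)\<close> into
    \<open>(1 - \<alpha>) / \<alpha>\<close>.\<close>
  moreover have "\<alpha> * (1 - \<alpha>) * (norm ((x - y) - (u - v)))\<^sup>2
      = (1 - \<alpha>) / \<alpha> * (norm ((x - x') - (y - y')))\<^sup>2"
    unfolding res using \<alpha> by (simp add: power2_eq_square)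
  ultimately show ?thesis
    using uv by (simp add: algebra_simps)
qed

text \<open>The first bound only drops the residual term, so it holds on all of \<open>D\<close>,
  including points of \<V> where (b) is silent. The second trades the residual for the distance to
  \<open>S\<close>.\<close>

lemma infdist_image_le:
  fixes T :: "'a::euclidean_space \<Rightarrow> 'a set"
  assumes S: "closed S" "S \<noteq> {}"
    and T_S: "\<forall>y\<in>S. T y \<noteq> {}" "\<forall>y\<in>S. T y \<subseteq> F"
    and avg: "\<forall>y\<in>S. pointwise_almost_averaged T D y \<epsilon> \<alpha>"
    and x: "x \<in> D" "x' \<in> T x"
  shows "infdist x' F \<le> sqrt (1 + \<epsilon>) * infdist x S"
    and "\<lbrakk>\<kappa> > 0; \<forall>y\<in>S. \<forall>y'\<in>T y. infdist x S \<le> \<kappa> * norm ((x - x') - (y - y'))\<rbrakk>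
      \<Longrightarrow> infdist x' F \<le> sqrt (1 + \<epsilon> - (1 - \<alpha>) / (\<kappa>\<^sup>2 * \<alpha>)) * infdist x S"
proof -
  obtain y where y: "y \<in> S" "infdist x S = norm (x - y)"
    using infdist_attains_inf[OF S] by (metis dist_norm)
  then obtain y' where y': "y' \<in> T y" "y' \<in> F"
    using T_S by blast
  have \<alpha>: "0 < \<alpha>" "\<alpha> < 1"
    using avg y by (auto simp: pointwise_almost_averaged_def)
  let ?r = "norm ((x - x') - (y - y'))"
  have "0 \<le> infdist x' F" "infdist x' F \<le> norm (x' - y')"
    using y' infdist_le[of y' F x'] by (auto simp: dist_norm infdist_nonneg)
  then have "(infdist x' F)\<^sup>2 \<le> (norm (x' - y'))\<^sup>2"
    by (simp add: power_mono)
  also have "\<dots> \<le> (1 + \<epsilon>) * (norm (x - y))\<^sup>2 - (1 - \<alpha>) / \<alpha> * ?r\<^sup>2"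
    using avg x y y' by (intro pointwise_almost_averaged_norm_le) auto
  finally have le: "(infdist x' F)\<^sup>2 \<le> (1 + \<epsilon>) * (infdist x S)\<^sup>2 - (1 - \<alpha>) / \<alpha> * ?r\<^sup>2"
    using y by simp
  \<comment> \<open>No sign condition on \<open>q\<close>: the real \<open>sqrt\<close> is odd and
    multiplicative on all reals. For negative \<open>q\<close> the premise forces both distances to
    vanish.\<close>
  have sqrt_le: "infdist x' F \<le> sqrt q * infdist x S"
    if "(infdist x' F)\<^sup>2 \<le> q * (infdist x S)\<^sup>2" for q
    using real_le_rsqrt[OF that] by (simp add: real_sqrt_mult infdist_nonneg)
  have "0 \<le> (1 - \<alpha>) / \<alpha> * ?r\<^sup>2"
    using \<alpha> by simp
  with le show "infdist x' F \<le> sqrt (1 + \<epsilon>) * infdist x S"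
    by (intro sqrt_le) linarith
  assume \<kappa>: "\<kappa> > 0" "\<forall>y\<in>S. \<forall>y'\<in>T y. infdist x S \<le> \<kappa> * norm ((x - x') - (y - y'))"
  then have "infdist x S \<le> \<kappa> * ?r"
    using y y' by blast
  then have "(infdist x S)\<^sup>2 \<le> (\<kappa> * ?r)\<^sup>2"
    by (simp add: power_mono infdist_nonneg)
  then have "(infdist x S)\<^sup>2 / \<kappa>\<^sup>2 \<le> ?r\<^sup>2"
    using \<kappa>(1) by (simp add: power_mult_distrib field_simps)
  from mult_left_mono[OF this, of "(1 - \<alpha>) / \<alpha>"]
  have "(1 - \<alpha>) / (\<kappa>\<^sup>2 * \<alpha>) * (infdist x S)\<^sup>2 \<le> (1 - \<alpha>) / \<alpha> * ?r\<^sup>2"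
    using \<alpha> by (simp add: mult.commute)
  with le show "infdist x' F \<le> sqrt (1 + \<epsilon> - (1 - \<alpha>) / (\<kappa>\<^sup>2 * \<alpha>)) * infdist x S"
    by (intro sqrt_le) (simp add: algebra_simps)
qed

text \<open>The bound on \<kappa> rearranges to
  \<open>\<epsilon> < (1 - \<alpha>) / (\<alpha> * \<kappa>\<^sup>2)\<close>, so the radicand is
  below 1. The case \<open>\<epsilon> = 0\<close> is a separate disjunct because division by zero
  yields 0 in HOL, not the intended infinite bound.\<close>

lemma linear_rate_lt_one:
  fixes \<epsilon> \<alpha> \<kappa> :: real
  assumes "0 < \<alpha>" "\<alpha> < 1" "0 \<le> \<epsilon>" "\<kappa> > 0"
    and "\<epsilon> = 0 \<or> \<kappa> < sqrt ((1 - \<alpha>) / (\<epsilon> * \<alpha>))"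
  shows "sqrt (max 0 (1 + \<epsilon> - (1 - \<alpha>) / (\<alpha> * \<kappa>\<^sup>2))) < 1"
proof -
  have "\<epsilon> < (1 - \<alpha>) / (\<alpha> * \<kappa>\<^sup>2)"
  proof (cases "\<epsilon> = 0")
    case False
    have "0 \<le> (1 - \<alpha>) / (\<epsilon> * \<alpha>)"
      using assms(1-3) by simp
    have "\<kappa>\<^sup>2 < (sqrt ((1 - \<alpha>) / (\<epsilon> * \<alpha>)))\<^sup>2"
      using False assms by (intro power_strict_mono) auto
    also have "\<dots> = (1 - \<alpha>) / (\<epsilon> * \<alpha>)"
      by (rule real_sqrt_pow2) fact
    finally show ?thesis
      using False assms(1-4) by (simp add: field_simps)
  qed (use assms in simp)
  then show ?thesis
    by simp
qed

theorem theorem2p1: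
  fixes T :: "'a::euclidean_space \<Rightarrow> 'a set"
    and \<Lambda> S \<O> \<V> :: "'a set"
    and \<epsilon> \<alpha> \<kappa> :: real
  assumes T_invariant: "\<forall>x\<in>\<Lambda>. T x \<subseteq> \<Lambda>"
    and S_sub: "S \<subseteq> rel_interior \<Lambda>"
    and S_closed: "closed S"
    and S_nonempty: "S \<noteq> {}"
    and T_nonempty: "\<forall>y\<in>S. T y \<noteq> {}"
    and T_S: "\<forall>y\<in>S. T y \<subseteq> Fix_pts T \<inter> S"
    and O_nbhd: "nbhd_of \<O> S"
    and O_sub: "\<O> \<inter> \<Lambda> \<subseteq> rel_interior \<Lambda>"
    and almost_averaged: "\<forall>y\<in>S. pointwise_almost_averaged T (\<O> \<inter> \<Lambda>) y \<epsilon> \<alpha>"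
    and V_nbhd: "nbhd_of \<V> (Fix_pts T \<inter> S)"
    and kappa_pos: "\<kappa> > 0"
    and metric_subreg:
      "\<forall>y\<in>S. \<forall>y'\<in>T y. \<forall>x \<in> (\<O> \<inter> \<Lambda>) - (\<V> \<inter> \<Lambda>). \<forall>x'\<in>T x.
         infdist x S \<le> \<kappa> * norm ((x - x') - (y - y'))"
  shows "(\<forall>x \<in> (\<O> \<inter> \<Lambda>) - (\<V> \<inter> \<Lambda>). \<forall>x'\<in>T x.
            infdist x' (Fix_pts T \<inter> S)
              \<le> sqrt (1 + \<epsilon> - (1 - \<alpha>) / (\<kappa>\<^sup>2 * \<alpha>)) * infdist x S) \<and>
         (\<epsilon> = 0 \<or> \<kappa> < sqrt ((1 - \<alpha>) / (\<epsilon> * \<alpha>)) \<longrightarrow>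
            (let c = sqrt (max 0 (1 + \<epsilon> - (1 - \<alpha>) / (\<alpha> * \<kappa>\<^sup>2))) in
               c < 1 \<and>
               (\<forall>(x :: nat \<Rightarrow> 'a) j.
                  x 0 \<in> \<O> \<inter> \<Lambda> \<and>
                  (\<forall>i\<le>j. x (Suc i) \<in> T (x i)) \<and>
                  (\<forall>i\<in>{1..j}. x i \<in> (\<O> \<inter> \<Lambda>) - (\<V> \<inter> \<Lambda>)) \<longrightarrow>
                    (x 0 \<notin> \<V> \<or> \<epsilon> = 0 \<longrightarrow>
                       infdist (x (Suc j)) (Fix_pts T \<inter> S) \<le> c ^ j * infdist (x 0) S) \<and>
                    infdist (x (Suc j)) (Fix_pts T \<inter> S)
                      \<le> c ^ j * (sqrt (1 + \<epsilon>) * infdist (x 0) S))))"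
proof -
  define F where "F = Fix_pts T \<inter> S"
  define q where "q = 1 + \<epsilon> - (1 - \<alpha>) / (\<kappa>\<^sup>2 * \<alpha>)"
  \<comment> \<open>Clamping at 0 keeps \<open>c\<close> nonnegative, as chaining requires;
    \<open>sqrt q\<close> itself is negative when \<open>q\<close> is.\<close>
  define c where "c = sqrt (max 0 q)"
  have params: "0 < \<alpha>" "\<alpha> < 1" "0 \<le> \<epsilon>"
    using almost_averaged S_nonempty by (auto simp: pointwise_almost_averaged_def)
  \<comment> \<open>Nonemptiness matters: \<open>infdist\<close> to the empty set is 0, so
    monotonicity in the set would fail.\<close>
  have F: "F \<subseteq> S" "F \<noteq> {}"
    using S_nonempty T_nonempty T_S unfolding F_def by blast+
  note image_le = infdist_image_le[OF S_closed S_nonempty T_nonempty, of F,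
      OF T_S[folded F_def] almost_averaged]
  have contraction: "infdist x' F \<le> sqrt q * infdist x S"
    if "x \<in> (\<O> \<inter> \<Lambda>) - (\<V> \<inter> \<Lambda>)" "x' \<in> T x" for x x'
    unfolding q_def using that kappa_pos metric_subreg by (intro image_le(2)) auto
  have step: "infdist x' F \<le> c * infdist x S"
    if "x \<in> (\<O> \<inter> \<Lambda>) - (\<V> \<inter> \<Lambda>)" "x' \<in> T x" for x x'
  proof -
    have "sqrt q \<le> c"
      by (simp add: c_def)
    then have "sqrt q * infdist x S \<le> c * infdist x S"
      by (intro mult_right_mono infdist_nonneg)
    with contraction[OF that] show ?thesis
      by linarith
  qed
  have "0 \<le> c"
    by (simp add: c_def)
  have c: "c < 1" if "\<epsilon> = 0 \<or> \<kappa> < sqrt ((1 - \<alpha>) / (\<epsilon> * \<alpha>))"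
    using linear_rate_lt_one[OF params kappa_pos that] by (simp add: c_def q_def mult.commute)
  \<comment> \<open>Membership outside \<V> is known only from index 1 on, so the induction starts
    from a bound \<open>B\<close> on the first iterate. The \<open>j\<close> later steps each
    contribute one factor \<open>c\<close>.\<close>
  have iter: "infdist (x (Suc j)) F \<le> c ^ j * B"
    if "infdist (x 1) F \<le> B" "\<forall>i\<le>j. x (Suc i) \<in> T (x i)"
      "\<forall>i\<in>{1..j}. x i \<in> (\<O> \<inter> \<Lambda>) - (\<V> \<inter> \<Lambda>)" for x :: "nat \<Rightarrow> 'a" and j B
    using that
  proof (induction j)
    case (Suc j)
    have "infdist (x (Suc (Suc j))) F \<le> c * infdist (x (Suc j)) S"
      using Suc.prems by (intro step) auto
    also have "\<dots> \<le> c * infdist (x (Suc j)) F"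
      using F \<open>0 \<le> c\<close> by (intro mult_left_mono infdist_mono)
    also have "\<dots> \<le> c * (c ^ j * B)"
      using Suc.prems \<open>0 \<le> c\<close> by (intro mult_left_mono Suc.IH) auto
    finally show ?case
      by (simp add: mult.assoc)
  qed simp
  \<comment> \<open>The first step does not increase the distance in two cases: for
    \<open>\<epsilon> = 0\<close> the factor \<open>sqrt (1 + \<epsilon>)\<close> is 1, and for
    \<open>x 0\<close> outside \<V> the factor is \<open>c < 1\<close>.\<close>
  have first: "infdist (x 1) F \<le> infdist (x 0) S"
    if "\<epsilon> = 0 \<or> \<kappa> < sqrt ((1 - \<alpha>) / (\<epsilon> * \<alpha>))" "x 0 \<in> \<O> \<inter> \<Lambda>" "x 1 \<in> T (x 0)"
      "x 0 \<notin> \<V> \<or> \<epsilon> = 0" for x :: "nat \<Rightarrow> 'a"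
  proof (cases "\<epsilon> = 0")
    case True
    then show ?thesis
      using image_le(1)[OF that(2,3)] by simp
  next
    case False
    then have "infdist (x 1) F \<le> c * infdist (x 0) S"
      using that by (intro step) auto
    also have "\<dots> \<le> infdist (x 0) S"
      using c[OF that(1)] \<open>0 \<le> c\<close> by (intro mult_left_le_one_le) (auto simp: infdist_nonneg)
    finally show ?thesis .
  qed
  have c_eq: "sqrt (max 0 (1 + \<epsilon> - (1 - \<alpha>) / (\<alpha> * \<kappa>\<^sup>2))) = c"
    by (simp add: c_def q_def mult.commute)
  show ?thesis
    unfolding F_def[symmetric] q_def[symmetric] c_eq Let_def
  proof (intro conjI impI ballI allI; (elim conjE)?)
    fix x :: "nat \<Rightarrow> 'a" and j
    assume rate: "\<epsilon> = 0 \<or> \<kappa> < sqrt ((1 - \<alpha>) / (\<epsilon> * \<alpha>))"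
      and x: "x 0 \<in> \<O> \<inter> \<Lambda>" "\<forall>i\<le>j. x (Suc i) \<in> T (x i)"
        "\<forall>i\<in>{1..j}. x i \<in> (\<O> \<inter> \<Lambda>) - (\<V> \<inter> \<Lambda>)"
    then have x1: "x 1 \<in> T (x 0)"
      by simp
    \<comment> \<open>If \<open>x 0\<close> lies in \<V> and \<epsilon> is positive, the first step
      is controlled only by almost averagedness. This costs the factor
      \<open>sqrt (1 + \<epsilon>)\<close> once.\<close>
    show "infdist (x (Suc j)) F \<le> c ^ j * (sqrt (1 + \<epsilon>) * infdist (x 0) S)"
      by (rule iter[OF image_le(1)[OF x(1) x1] x(2,3)])
    assume "x 0 \<notin> \<V> \<or> \<epsilon> = 0"
    then show "infdist (x (Suc j)) F \<le> c ^ j * infdist (x 0) S"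
      by (intro iter[OF first[OF rate x(1) x1] x(2,3)])
  qed (use contraction c in auto)
qed

end
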